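(* Let $(\Omega,\mathcal{F},\mathbb{P})$ be a probability space, let $\alpha\in(0,1)$ and let $S=(S_0,S_1)$ be an eligible asset. The risk measure $S\text{-}\mathrm{ES}_\alpha$ is comonotonic if and only if $S$ is risk-free.
   Context: $L^\infty=L^\infty(\Omega,\mathcal{F},\mathbb{P})$ is the space of (a.s.-equivalence classes of) essentially bounded real random variables, and $L^\infty_+=\{X\in L^\infty : X\ge 0 \text{ a.s.}\}$. An eligible asset is a pair $S=(S_0,S_1)\in(0,\infty)\times L^\infty_+$ with $S_1\ge\varepsilon$ a.s. for some constant $\varepsilon>0$; $S$ is risk-free if $S_1$ is (a.s.) constant. For $\beta\in(0,1)$ and $X\in L^\infty$, $\mathrm{VaR}_\beta(X)=\inf\{m\in\mathbb{R} : \mathbb{P}(X+m<0)\leq\beta\}$, and $\mathrm{ES}_\alpha(X)=\frac{1}{\alpha}\int_0^\alpha\mathrm{VaR}_\beta(X)\,d\beta$. The risk measure $S\text{-}\mathrm{ES}_\alpha:L^\infty\to\mathbb{R}$ is defined by $S\text{-}\mathrm{ES}_\alpha(X)=\inf\{m\in\mathbb{R} : \mathrm{ES}_\alpha(X+\tfrac{m}{S_0}S_1)\leq0\}$. Two random variables $X,Y\in L^\infty$ are comonotone if there is a $\mathbb{P}\otimes\mathbb{P}$-null set $N$ such that $(X(\omega)-X(\omega'))(Y(\omega)-Y(\omega'))\ge0$ for all $(\omega,\omega')\in(\Omega\times\Omega)\setminus N$. A functional $\rho:L^\infty\to\mathbb{R}$ is comonotonic if $\rho(X+Y)=\rho(X)+\rho(Y)$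 for all comonotone $X,Y\in L^\infty$. *)

theory Defs
  imports "HOL-Probability.Probability"
begin

text \<open>
  Elements of \<open>L\<^sup>\<infinity>\<close> are handled through measurable representatives. The lemmas at the end show
  that the risk measures and comonotonicity depend only on almost-sure equivalence classes.
\<close>

definition Linf :: "'a measure \<Rightarrow> ('a \<Rightarrow> real) set" where
  "Linf M = {X \<in> borel_measurable M. \<exists>C. AE \<omega> in M. \<bar>X \<omega>\<bar> \<le> C}"

definition Linf_plus :: "'a measure \<Rightarrow> ('a \<Rightarrow> real) set" where
  "Linf_plus M = {X \<in> Linf M. AE \<omega> in M. 0 \<le> X \<omega>}"

definition eligible_asset :: "'a measure \<Rightarrow> real \<times> ('a \<Rightarrow> real) \<Rightarrow> bool" where
  "eligible_asset M S \<longleftrightarrow>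
     0 < fst S \<and> snd S \<in> Linf_plus M \<and> (\<exists>\<epsilon>>0. AE \<omega> in M. \<epsilon> \<le> snd S \<omega>)"

definition risk_free :: "'a measure \<Rightarrow> real \<times> ('a \<Rightarrow> real) \<Rightarrow> bool" where
  "risk_free M S \<longleftrightarrow> (\<exists>c. AE \<omega> in M. snd S \<omega> = c)"

definition VaR :: "'a measure \<Rightarrow> real \<Rightarrow> ('a \<Rightarrow> real) \<Rightarrow> real" where
  "VaR M \<beta> X = Inf {m. measure M {\<omega> \<in> space M. X \<omega> + m < 0} \<le> \<beta>}"

definition ES :: "'a measure \<Rightarrow> real \<Rightarrow> ('a \<Rightarrow> real) \<Rightarrow> real" where
  "ES M \<alpha> X = 1 / \<alpha> * (LBINT \<beta>:{0<..<\<alpha>}. VaR M \<beta> X)"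

definition S_ES :: "'a measure \<Rightarrow> real \<times> ('a \<Rightarrow> real) \<Rightarrow> real \<Rightarrow> ('a \<Rightarrow> real) \<Rightarrow> real" where
  "S_ES M S \<alpha> X = Inf {m. ES M \<alpha> (\<lambda>\<omega>. X \<omega> + m / fst S * snd S \<omega>) \<le> 0}"

definition comonotone :: "'a measure \<Rightarrow> ('a \<Rightarrow> real) \<Rightarrow> ('a \<Rightarrow> real) \<Rightarrow> bool" where
  "comonotone M X Y \<longleftrightarrow>
     (\<exists>N \<in> null_sets (M \<Otimes>\<^sub>M M). \<forall>(\<omega>, \<omega>') \<in> (space M \<times> space M) - N.
        0 \<le> (X \<omega> - X \<omega>') * (Y \<omega> - Y \<omega>'))"

definition comonotonic :: "'a measure \<Rightarrow> (('a \<Rightarrow> real) \<Rightarrow> real) \<Rightarrow> bool" where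
  "comonotonic M \<rho> \<longleftrightarrow>
     (\<forall>X \<in> Linf M. \<forall>Y \<in> Linf M. comonotone M X Y \<longrightarrow> \<rho> (\<lambda>\<omega>. X \<omega> + Y \<omega>) = \<rho> X + \<rho> Y)"

lemma VaR_cong_AE:
  assumes "X \<in> borel_measurable M" "X' \<in> borel_measurable M" "AE \<omega> in M. X \<omega> = X' \<omega>"
  shows "VaR M \<beta> X = VaR M \<beta> X'"
proof -
  have "measure M {\<omega> \<in> space M. X \<omega> + m < 0} = measure M {\<omega> \<in> space M. X' \<omega> + m < 0}" for m
    by (rule measure_eq_AE) (use assms in auto)
  then show ?thesis
    by (simp add: VaR_def)
qed

lemma ES_cong_AE:
  assumes "X \<in> borel_measurable M" "X' \<in> borel_measurable M" "AE \<omega> in M. X \<omega> = X' \<omega>"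
  shows "ES M \<alpha> X = ES M \<alpha> X'"
  using VaR_cong_AE[OF assms] by (simp add: ES_def)

lemma S_ES_cong_AE:
  assumes X: "X \<in> borel_measurable M" "X' \<in> borel_measurable M" "AE \<omega> in M. X \<omega> = X' \<omega>"
    and S: "S1 \<in> borel_measurable M" "S1' \<in> borel_measurable M" "AE \<omega> in M. S1 \<omega> = S1' \<omega>"
  shows "S_ES M (S0, S1) \<alpha> X = S_ES M (S0, S1') \<alpha> X'"
proof -
  have "ES M \<alpha> (\<lambda>\<omega>. X \<omega> + m / S0 * S1 \<omega>) = ES M \<alpha> (\<lambda>\<omega>. X' \<omega> + m / S0 * S1' \<omega>)" for m
    by (rule ES_cong_AE) (use assms in auto)
  then show ?thesis
    by (simp add: S_ES_def)
qed

lemma comonotone_cong_AE: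
  assumes "prob_space M" "AE \<omega> in M. X \<omega> = X' \<omega>" "AE \<omega> in M. Y \<omega> = Y' \<omega>" "comonotone M X Y"
  shows "comonotone M X' Y'"
proof -
  interpret prob_space M by fact
  from assms(2,3) have "AE \<omega> in M. X \<omega> = X' \<omega> \<and> Y \<omega> = Y' \<omega>"
    by eventually_elim simp
  then obtain A where A: "A \<in> null_sets M"
      and eq: "\<And>\<omega>. \<omega> \<in> space M - A \<Longrightarrow> X \<omega> = X' \<omega> \<and> Y \<omega> = Y' \<omega>"
    by (auto elim!: AE_E3)
  obtain N where N: "N \<in> null_sets (M \<Otimes>\<^sub>M M)"
      and pos: "\<forall>(\<omega>, \<omega>') \<in> (space M \<times> space M) - N. 0 \<le> (X \<omega> - X \<omega>') * (Y \<omega> - Y \<omega>')"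
    using assms(4) by (auto simp: comonotone_def)
  have "A \<times> space M \<in> null_sets (M \<Otimes>\<^sub>M M)" "space M \<times> A \<in> null_sets (M \<Otimes>\<^sub>M M)"
    using A by (auto simp: null_sets_def emeasure_pair_measure_Times)
  with N have "N \<union> (A \<times> space M \<union> space M \<times> A) \<in> null_sets (M \<Otimes>\<^sub>M M)"
    by auto
  moreover have "0 \<le> (X' \<omega> - X' \<omega>') * (Y' \<omega> - Y' \<omega>')"
    if "(\<omega>, \<omega>') \<in> (space M \<times> space M) - (N \<union> (A \<times> space M \<union> space M \<times> A))" for \<omega> \<omega>'
  proof -
    from that pos have "0 \<le> (X \<omega> - X \<omega>') * (Y \<omega> - Y \<omega>')"
      by blast
    moreover from that have "\<omega> \<in> space M - A" "\<omega>' \<in> space M - A"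
      by auto
    ultimately show ?thesis
      using eq[of \<omega>] eq[of \<omega>'] by simp
  qed
  ultimately show ?thesis
    unfolding comonotone_def by blast
qed

end

theory Submission
  imports Defs
begin

text \<open>
  For comonotone \<open>X\<close> and \<open>Y\<close> the events \<open>X < s\<close> and \<open>Y < t\<close> are nested up to null sets, so every
  \<open>VaR\<^sub>\<beta>\<close>, and hence \<open>ES\<^sub>\<alpha>\<close>, is additive on them; if \<open>S\<^sub>1 = c\<close> is constant, the \<open>S\<close>-based risk measure
  is \<open>S\<^sub>0 / c\<close> times \<open>ES\<^sub>\<alpha>\<close>.
  Conversely, the constants \<open>1\<close> and \<open>-1\<close> are comonotone with sum \<open>0\<close>; evaluating the risk measure
  at the three constants gives \<open>ES\<^sub>\<alpha>(S\<^sub>1) + ES\<^sub>\<alpha>(-S\<^sub>1) = 0\<close>. But \<open>ES\<^sub>\<alpha>(X) \<ge> -E[X]\<close> with equality only for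
  constant \<open>X\<close>, because \<open>\<alpha> < 1\<close>.
\<close>

section \<open>Preliminaries on order, integrals and constants\<close>

text \<open>Serves to prove identities for \<open>VaR\<close>, which is accessible only through the
  levels \<open>m\<close> above it.\<close>

lemma eq_of_le_iff:
  fixes a b :: "'a::order"
  assumes "\<And>m. a \<le> m \<longleftrightarrow> b \<le> m"
  shows "a = b"
  using assms[of a] assms[of b] by auto

lemma set_integral_const_Ioo:
  fixes a b c :: real
  assumes "a \<le> b"
  shows "(LBINT x:{a<..<b}. c) = (b - a) * c"
  using assms by (simp add: set_lebesgue_integral_def)

lemma comonotone_const: "comonotone M (\<lambda>_. c) Y"
  unfolding comonotone_def by (intro bexI[of _ "{}"]) auto

context prob_space
begin

lemma Linf_integrable: "X \<in> Linf M \<Longrightarrow> integrable M X"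
  unfolding Linf_def using integrable_const_bound[where 'b=real] by auto

lemma Linf_const: "(\<lambda>_. c) \<in> Linf M"
  unfolding Linf_def by auto

section \<open>Value at Risk as a quantile\<close>

text \<open>The event \<open>X + m < 0\<close> is the complement of \<open>- X \<le> m\<close>, so
  \<open>VaR M \<beta> X\<close> is the generalised inverse at \<open>1 - \<beta>\<close> of the
  distribution function of \<open>- X\<close>. Right continuity of that function makes the infimum
  attained.\<close>

lemma VaR_le_iff:
  assumes [measurable]: "X \<in> borel_measurable M" and \<beta>: "0 < \<beta>" "\<beta> < 1"
  shows "VaR M \<beta> X \<le> m \<longleftrightarrow> prob {\<omega> \<in> space M. X \<omega> + m < 0} \<le> \<beta>"
proof -
  define D where "D = distr M borel (\<lambda>\<omega>. - X \<omega>)"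
  interpret D: real_distribution D
    unfolding D_def by simp
  interpret D: cdf_distribution D ..
  have cdf: "cdf D m = 1 - prob {\<omega> \<in> space M. X \<omega> + m < 0}" for m
  proof -
    have "cdf D m = prob (space M - {\<omega> \<in> space M. X \<omega> + m < 0})"
      unfolding cdf_def D_def
      by (subst measure_distr) (auto intro!: arg_cong[where f=prob])
    then show ?thesis
      by (simp add: prob_compl)
  qed
  have "1 - \<beta> \<le> cdf D m \<longleftrightarrow> Inf {x. 1 - \<beta> \<le> cdf D x} \<le> m"
    using \<beta> by (intro D.pseudoinverse) auto
  then show ?thesis
    by (simp add: cdf VaR_def)
qed

lemma VaR_antimono:
  assumes X: "X \<in> borel_measurable M" and "0 < \<beta>" "\<beta> \<le> \<gamma>" "\<gamma> < 1"
  shows "VaR M \<gamma> X \<le> VaR M \<beta> X"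
proof -
  \<comment> \<open>The infimum is attained: the equivalence is taken at the value of
    \<open>VaR\<close> itself.\<close>
  have "prob {\<omega> \<in> space M. X \<omega> + VaR M \<beta> X < 0} \<le> \<beta>"
    using VaR_le_iff[OF X, of \<beta> "VaR M \<beta> X"] assms by simp
  then show ?thesis
    using VaR_le_iff[OF X, of \<gamma>] assms by simp
qed

lemma VaR_mono:
  assumes [measurable]: "X \<in> borel_measurable M" "Y \<in> borel_measurable M"
    and le: "AE \<omega> in M. X \<omega> \<le> Y \<omega>" and \<beta>: "0 < \<beta>" "\<beta> < 1"
  shows "VaR M \<beta> Y \<le> VaR M \<beta> X"
proof -
  let ?v = "VaR M \<beta> X"
  have "prob {\<omega> \<in> space M. Y \<omega> + ?v < 0} \<le> prob {\<omega> \<in> space M. X \<omega> + ?v < 0}"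
    using le by (intro finite_measure_mono_AE) auto
  also have "\<dots> \<le> \<beta>"
    using VaR_le_iff[of X \<beta> ?v] \<beta> by simp
  finally show ?thesis
    using VaR_le_iff[of Y \<beta>] \<beta> by simp
qed

lemma VaR_cash_additive:
  assumes [measurable]: "X \<in> borel_measurable M" and \<beta>: "0 < \<beta>" "\<beta> < 1"
  shows "VaR M \<beta> (\<lambda>\<omega>. X \<omega> + c) = VaR M \<beta> X - c"
proof (rule eq_of_le_iff)
  fix m
  show "VaR M \<beta> (\<lambda>\<omega>. X \<omega> + c) \<le> m \<longleftrightarrow> VaR M \<beta> X - c \<le> m"
    using VaR_le_iff[of "\<lambda>\<omega>. X \<omega> + c" \<beta> m] VaR_le_iff[of X \<beta> "c + m"] \<beta>
    by (simp add: algebra_simps)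
qed

lemma VaR_pos_homogeneous:
  assumes [measurable]: "X \<in> borel_measurable M" and \<beta>: "0 < \<beta>" "\<beta> < 1" and k: "0 < k"
  shows "VaR M \<beta> (\<lambda>\<omega>. k * X \<omega>) = k * VaR M \<beta> X"
proof (rule eq_of_le_iff)
  fix m
  have "k * x + m < 0 \<longleftrightarrow> x + m / k < 0" for x
    using k by (simp add: field_simps)
  then show "VaR M \<beta> (\<lambda>\<omega>. k * X \<omega>) \<le> m \<longleftrightarrow> k * VaR M \<beta> X \<le> m"
    using VaR_le_iff[of "\<lambda>\<omega>. k * X \<omega>" \<beta> m] VaR_le_iff[of X \<beta> "m / k"] \<beta> k
    by (simp add: field_simps)
qed

lemma VaR_const:
  assumes \<beta>: "0 < \<beta>" "\<beta> < 1"
  shows "VaR M \<beta> (\<lambda>_. c) = - c"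
proof (rule eq_of_le_iff)
  fix m
  show "VaR M \<beta> (\<lambda>_. c) \<le> m \<longleftrightarrow> - c \<le> m"
    using VaR_le_iff[of "\<lambda>_. c" \<beta> m] \<beta> by (cases "c + m < 0") (auto simp: prob_space)
qed

section \<open>Comonotone additivity of Value at Risk\<close>

text \<open>A point of one difference and a point of the other order \<open>X\<close> and
  \<open>Y\<close> oppositely, so the rectangle spanned by the two differences lies in the
  exceptional null set. Its measure is the product of the two probabilities, hence one of them
  vanishes.\<close>

lemma comonotone_nested:
  assumes [measurable]: "X \<in> borel_measurable M" "Y \<in> borel_measurable M"
    and XY: "comonotone M X Y"
  defines "A \<equiv> \<lambda>s. {\<omega> \<in> space M. X \<omega> < s}" and "B \<equiv> \<lambda>t. {\<omega> \<in> space M. Y \<omega> < t}"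
  shows "prob (A s - B t) = 0 \<or> prob (B t - A s) = 0"
proof -
  have [measurable]: "A s \<in> sets M" "B t \<in> sets M"
    unfolding A_def B_def by measurable
  obtain N where N: "N \<in> null_sets (M \<Otimes>\<^sub>M M)"
    and pos: "\<And>\<omega> \<omega>'. \<lbrakk>\<omega> \<in> space M; \<omega>' \<in> space M; (\<omega>, \<omega>') \<notin> N\<rbrakk>
      \<Longrightarrow> 0 \<le> (X \<omega> - X \<omega>') * (Y \<omega> - Y \<omega>')"
    using XY unfolding comonotone_def by blast
  have "(A s - B t) \<times> (B t - A s) \<subseteq> N"
  proof clarify
    fix \<omega> \<omega>' assume *: "\<omega> \<in> A s" "\<omega> \<notin> B t" "\<omega>' \<in> B t" "\<omega>' \<notin> A s"
    then have "X \<omega> - X \<omega>' < 0" "Y \<omega> - Y \<omega>' > 0"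
      by (auto simp: A_def B_def)
    then have "(X \<omega> - X \<omega>') * (Y \<omega> - Y \<omega>') < 0"
      by (rule mult_neg_pos)
    with * pos[of \<omega> \<omega>'] show "(\<omega>, \<omega>') \<in> N"
      by (force simp: A_def B_def)
  qed
  then have "(A s - B t) \<times> (B t - A s) \<in> null_sets (M \<Otimes>\<^sub>M M)"
    using N by (rule null_sets_subset[rotated 2]) auto
  then have "emeasure M (A s - B t) * emeasure M (B t - A s) = 0"
    by (simp add: null_sets_def emeasure_pair_measure_Times)
  then show ?thesis
    by (auto simp: measure_def)
qed

text \<open>For events nested up to null sets, the union has the larger and the intersection the
  smaller of the two probabilities. The union bounds the event for \<open>X + Y\<close> from above,
  the intersection from below.\<close>

lemma VaR_comonotone_additive:
  assumes [measurable]: "X \<in> borel_measurable M" "Y \<in> borel_measurable M"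
    and XY: "comonotone M X Y" and \<beta>: "0 < \<beta>" "\<beta> < 1"
  shows "VaR M \<beta> (\<lambda>\<omega>. X \<omega> + Y \<omega>) = VaR M \<beta> X + VaR M \<beta> Y"
proof (rule antisym)
  define A where "A = (\<lambda>s. {\<omega> \<in> space M. X \<omega> < s})"
  define B where "B = (\<lambda>t. {\<omega> \<in> space M. Y \<omega> < t})"
  have meas [measurable]: "A s \<in> sets M" "B t \<in> sets M" for s t
    unfolding A_def B_def by measurable
  have nested: "prob (A s - B t) = 0 \<or> prob (B t - A s) = 0" for s t
    using comonotone_nested[OF assms(1-3)] by (simp add: A_def B_def)
  have shift: "x + m < 0 \<longleftrightarrow> x < - m" for x m :: real
    by linarith
  have VX: "VaR M \<beta> X \<le> m \<longleftrightarrow> prob (A (- m)) \<le> \<beta>" for m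
    using VaR_le_iff[OF assms(1) \<beta>, of m] by (simp add: A_def shift)
  have VY: "VaR M \<beta> Y \<le> m \<longleftrightarrow> prob (B (- m)) \<le> \<beta>" for m
    using VaR_le_iff[OF assms(2) \<beta>, of m] by (simp add: B_def shift)
  have VXY: "VaR M \<beta> (\<lambda>\<omega>. X \<omega> + Y \<omega>) \<le> m \<longleftrightarrow> prob {\<omega> \<in> space M. X \<omega> + Y \<omega> + m < 0} \<le> \<beta>" for m
    using \<beta> by (intro VaR_le_iff) auto
  show "VaR M \<beta> (\<lambda>\<omega>. X \<omega> + Y \<omega>) \<le> VaR M \<beta> X + VaR M \<beta> Y"
  proof -
    define a b where "a = VaR M \<beta> X" and "b = VaR M \<beta> Y"
    have ab: "prob (A (- a)) \<le> \<beta>" "prob (B (- b)) \<le> \<beta>"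
      using VX[of a] VY[of b] by (auto simp: a_def b_def)
    have "prob {\<omega> \<in> space M. X \<omega> + Y \<omega> + (a + b) < 0} \<le> prob (A (- a) \<union> B (- b))"
      by (intro finite_measure_mono) (auto simp: A_def B_def)
    also have "\<dots> \<le> \<beta>"
      using nested[of "- a" "- b"]
    proof
      assume "prob (A (- a) - B (- b)) = 0"
      then show ?thesis
        using ab finite_measure_Union'[of "B (- b)" "A (- a)"] by (simp add: Un_commute)
    next
      assume "prob (B (- b) - A (- a)) = 0"
      then show ?thesis
        using ab finite_measure_Union'[of "A (- a)" "B (- b)"] by simp
    qed
    finally show ?thesis
      using VXY by (simp add: a_def b_def)
  qed
  show "VaR M \<beta> X + VaR M \<beta> Y \<le> VaR M \<beta> (\<lambda>\<omega>. X \<omega> + Y \<omega>)"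
  proof (rule ccontr)
    define m where "m = VaR M \<beta> (\<lambda>\<omega>. X \<omega> + Y \<omega>)"
    \<comment> \<open>Half of the assumed gap: both thresholds drop strictly below their
      \<open>VaR\<close>, yet still sum to \<open>m\<close>.\<close>
    define d where "d = (VaR M \<beta> X + VaR M \<beta> Y - m) / 2"
    define a b where "a = VaR M \<beta> X - d" and "b = VaR M \<beta> Y - d"
    assume "\<not> ?thesis"
    then have "0 < d"
      by (simp add: d_def m_def)
    then have ab: "\<beta> < prob (A (- a))" "\<beta> < prob (B (- b))"
      using VX[of a] VY[of b] by (auto simp: a_def b_def)
    have m: "m = a + b"
      by (simp add: a_def b_def d_def field_simps)
    have "\<beta> < prob (A (- a) \<inter> B (- b))"
      using nested[of "- a" "- b"]
    proof
      assume "prob (A (- a) - B (- b)) = 0"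
      then show ?thesis
        using ab finite_measure_Diff'[of "A (- a)" "B (- b)"] by simp
    next
      assume "prob (B (- b) - A (- a)) = 0"
      then show ?thesis
        using ab finite_measure_Diff'[of "B (- b)" "A (- a)"] by (simp add: Int_commute)
    qed
    also have "\<dots> \<le> prob {\<omega> \<in> space M. X \<omega> + Y \<omega> + m < 0}"
      by (intro finite_measure_mono) (auto simp: A_def B_def m)
    also have "\<dots> \<le> \<beta>"
      using VXY[of m] by (simp add: m_def)
    finally show False
      by simp
  qed
qed

section \<open>The quantile transform on the unit interval\<close>

text \<open>Measurability comes from monotonicity in \<beta>; the sign is flipped because
  \<open>VaR\<close> decreases.\<close>

lemma measurable_VaR:
  assumes "X \<in> borel_measurable M"
  shows "(\<lambda>\<beta>. VaR M \<beta> X) \<in> borel_measurable (restrict_space lborel {0<..<1})"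
proof -
  have "(\<lambda>\<beta>. - VaR M \<beta> X) \<in> borel_measurable (restrict_space borel {0<..<1})"
    using VaR_antimono[OF assms]
    by (intro borel_measurable_mono_on_fnc) (auto simp: mono_on_def)
  then have "(\<lambda>\<beta>. - (- VaR M \<beta> X)) \<in> borel_measurable (restrict_space borel {0<..<1})"
    by (rule borel_measurable_uminus)
  then show ?thesis
    by (simp cong: measurable_cong_sets add: sets_restrict_space)
qed

text \<open>For \<beta> uniform on the unit interval, \<open>VaR M \<beta> X\<close> has the law of
  \<open>- X\<close>: by \<open>VaR_le_iff\<close> both distribution functions at \<open>m\<close>
  equal \<open>1 - p\<close>.\<close>

lemma distr_VaR:
  assumes X [measurable]: "X \<in> borel_measurable M"
  shows "distr (restrict_space lborel {0<..<1}) borel (\<lambda>\<beta>. VaR M \<beta> X)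
    = distr M borel (\<lambda>\<omega>. - X \<omega>)" (is "?D = ?E")
proof (intro cdf_unique ext)
  let ?\<Omega> = "restrict_space lborel {0<..<1::real}"
  interpret \<Omega>: prob_space ?\<Omega>
    by (auto simp add: emeasure_restrict_space space_restrict_space intro!: prob_spaceI)
  note [measurable] = measurable_VaR[OF X]
  show "real_distribution ?D"
    by simp
  show "real_distribution ?E"
    by simp
  fix m
  define p where "p = prob {\<omega> \<in> space M. X \<omega> + m < 0}"
  have "cdf ?D m = measure lborel {\<beta> \<in> {0<..<1}. p \<le> \<beta>}"
    unfolding cdf_def p_def
    by (subst measure_distr)
       (auto simp: VaR_le_iff space_restrict_space measure_restrict_space
             intro!: arg_cong2[where f=measure])
  \<comment> \<open>The two sets differ at most in the point \<open>p\<close>; nonnegativity of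
    \<open>p\<close> keeps the new interval inside the unit interval.\<close>
  also have "\<dots> = measure lborel {p <..< 1}"
    using AE_lborel_singleton[of p]
    by (auto intro!: arg_cong[where f=enn2real] emeasure_eq_AE simp: measure_def p_def
         elim!: eventually_mono intro: le_less_trans[OF measure_nonneg])
  also have "\<dots> = 1 - p"
    by (simp add: p_def)
  also have "\<dots> = prob (space M - {\<omega> \<in> space M. X \<omega> + m < 0})"
    by (simp add: prob_compl p_def)
  also have "\<dots> = cdf ?E m"
    unfolding cdf_def
    by (subst measure_distr) (auto intro!: arg_cong[where f=prob])
  finally show "cdf ?D m = cdf ?E m" .
qed

text \<open>Change of variables along the common law. The function \<open>h\<close> will be the
  identity, for integrability, and a shifted positive part, for the formula of Expected
  Shortfall.\<close>

lemma
  fixes h :: "real \<Rightarrow> real"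
  assumes X [measurable]: "X \<in> borel_measurable M" and h [measurable]: "h \<in> borel_measurable borel"
  shows set_integrable_VaR_iff:
      "set_integrable lborel {0<..<1} (\<lambda>\<beta>. h (VaR M \<beta> X)) \<longleftrightarrow> integrable M (\<lambda>\<omega>. h (- X \<omega>))"
    and set_integral_VaR:
      "(LBINT \<beta>:{0<..<1}. h (VaR M \<beta> X)) = expectation (\<lambda>\<omega>. h (- X \<omega>))"
proof -
  let ?\<Omega> = "restrict_space lborel {0<..<1::real}"
  note [measurable] = measurable_VaR[OF X]
  have "set_integrable lborel {0<..<1} (\<lambda>\<beta>. h (VaR M \<beta> X))
      \<longleftrightarrow> integrable ?\<Omega> (\<lambda>\<beta>. h (VaR M \<beta> X))"
    by (simp add: set_integrable_def integrable_restrict_space)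
  also have "\<dots> \<longleftrightarrow> integrable (distr ?\<Omega> borel (\<lambda>\<beta>. VaR M \<beta> X)) h"
    by (subst integrable_distr_eq) auto
  also have "\<dots> \<longleftrightarrow> integrable M (\<lambda>\<omega>. h (- X \<omega>))"
    unfolding distr_VaR[OF X] by (subst integrable_distr_eq) auto
  finally show "set_integrable lborel {0<..<1} (\<lambda>\<beta>. h (VaR M \<beta> X))
    \<longleftrightarrow> integrable M (\<lambda>\<omega>. h (- X \<omega>))" .
  have "(LBINT \<beta>:{0<..<1}. h (VaR M \<beta> X)) = (\<integral>\<beta>. h (VaR M \<beta> X) \<partial>?\<Omega>)"
    by (simp add: set_lebesgue_integral_def integral_restrict_space)
  also have "\<dots> = integral\<^sup>L (distr ?\<Omega> borel (\<lambda>\<beta>. VaR M \<beta> X)) h"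
    by (subst integral_distr) auto
  also have "\<dots> = expectation (\<lambda>\<omega>. h (- X \<omega>))"
    unfolding distr_VaR[OF X] by (subst integral_distr) auto
  finally show "(LBINT \<beta>:{0<..<1}. h (VaR M \<beta> X)) = expectation (\<lambda>\<omega>. h (- X \<omega>))" .
qed

section \<open>Expected Shortfall: basic properties\<close>

context
  fixes \<alpha> :: real
  assumes \<alpha>: "0 < \<alpha>" "\<alpha> < 1"
begin

text \<open>Integrability is transferred from \<open>- X\<close> to the whole unit interval and then
  restricted.\<close>

lemma set_integrable_VaR:
  assumes "integrable M X"
  shows "set_integrable lborel {0<..<\<alpha>} (\<lambda>\<beta>. VaR M \<beta> X)"
proof (rule set_integrable_subset)
  have "X \<in> borel_measurable M" "integrable M (\<lambda>\<omega>. - X \<omega>)"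
    using assms by auto
  then show "set_integrable lborel {0<..<1} (\<lambda>\<beta>. VaR M \<beta> X)"
    by (subst set_integrable_VaR_iff[where h="\<lambda>x. x"]) auto
qed (use \<alpha> in auto)

lemma ES_cash_additive:
  assumes "integrable M X"
  shows "ES M \<alpha> (\<lambda>\<omega>. X \<omega> + c) = ES M \<alpha> X - c"
proof -
  have "(LBINT \<beta>:{0<..<\<alpha>}. VaR M \<beta> (\<lambda>\<omega>. X \<omega> + c)) = (LBINT \<beta>:{0<..<\<alpha>}. VaR M \<beta> X - c)"
    using \<alpha> assms by (intro set_lebesgue_integral_cong) (auto simp: VaR_cash_additive)
  also have "\<dots> = (LBINT \<beta>:{0<..<\<alpha>}. VaR M \<beta> X) - \<alpha> * c"
    using \<alpha> set_integrable_VaR[OF assms]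
    by (subst set_integral_diff) (auto simp: set_integrable_def set_integral_const_Ioo)
  finally show ?thesis
    using \<alpha> by (simp add: ES_def field_simps)
qed

lemma ES_pos_homogeneous:
  assumes [measurable]: "X \<in> borel_measurable M" and "0 < k"
  shows "ES M \<alpha> (\<lambda>\<omega>. k * X \<omega>) = k * ES M \<alpha> X"
proof -
  have "(LBINT \<beta>:{0<..<\<alpha>}. VaR M \<beta> (\<lambda>\<omega>. k * X \<omega>)) = (LBINT \<beta>:{0<..<\<alpha>}. k * VaR M \<beta> X)"
    using \<alpha> assms by (intro set_lebesgue_integral_cong) (auto simp: VaR_pos_homogeneous)
  then show ?thesis
    by (simp add: ES_def)
qed

lemma ES_const: "ES M \<alpha> (\<lambda>_. c) = - c"
proof -
  have "(LBINT \<beta>:{0<..<\<alpha>}. VaR M \<beta> (\<lambda>_. c)) = (LBINT \<beta>:{0<..<\<alpha>}. - c)"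
    using \<alpha> by (intro set_lebesgue_integral_cong) (auto simp: VaR_const)
  then show ?thesis
    using \<alpha> by (simp add: ES_def set_integral_const_Ioo)
qed

lemma ES_mono:
  assumes "integrable M X" "integrable M Y" "AE \<omega> in M. X \<omega> \<le> Y \<omega>"
  shows "ES M \<alpha> Y \<le> ES M \<alpha> X"
proof -
  have "(LBINT \<beta>:{0<..<\<alpha>}. VaR M \<beta> Y) \<le> (LBINT \<beta>:{0<..<\<alpha>}. VaR M \<beta> X)"
    using \<alpha> assms by (intro set_integral_mono set_integrable_VaR VaR_mono) auto
  then show ?thesis
    using \<alpha> by (simp add: ES_def divide_right_mono)
qed

lemma ES_comonotone_additive:
  assumes "integrable M X" "integrable M Y" "comonotone M X Y"
  shows "ES M \<alpha> (\<lambda>\<omega>. X \<omega> + Y \<omega>) = ES M \<alpha> X + ES M \<alpha> Y"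
proof -
  have "(LBINT \<beta>:{0<..<\<alpha>}. VaR M \<beta> (\<lambda>\<omega>. X \<omega> + Y \<omega>))
      = (LBINT \<beta>:{0<..<\<alpha>}. VaR M \<beta> X + VaR M \<beta> Y)"
    using \<alpha> assms by (intro set_lebesgue_integral_cong) (auto simp: VaR_comonotone_additive)
  also have "\<dots> = (LBINT \<beta>:{0<..<\<alpha>}. VaR M \<beta> X) + (LBINT \<beta>:{0<..<\<alpha>}. VaR M \<beta> Y)"
    using assms by (intro set_integral_add set_integrable_VaR)
  finally show ?thesis
    by (simp add: ES_def distrib_left add_divide_distrib)
qed

section \<open>Expected Shortfall compared with the expectation\<close>

text \<open>This is the Rockafellar-Uryasev formula at its minimiser \<open>v\<close>. As
  \<open>VaR\<close> decreases in the level, its excess over \<open>v\<close> on the levels below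
  \<alpha> is its positive part on the whole unit interval, and that integral is an expectation by
  the quantile transform.\<close>

lemma ES_eq_expectation:
  assumes X: "integrable M X"
  defines "v \<equiv> VaR M \<alpha> X"
  shows "ES M \<alpha> X = v + 1 / \<alpha> * expectation (\<lambda>\<omega>. max (- X \<omega> - v) 0)"
proof -
  have [measurable]: "X \<in> borel_measurable M"
    using X by auto
  have "expectation (\<lambda>\<omega>. max (- X \<omega> - v) 0) = (LBINT \<beta>:{0<..<1}. max (VaR M \<beta> X - v) 0)"
    by (rule set_integral_VaR[symmetric]) auto
  also have "\<dots> = (LBINT \<beta>:{0<..<\<alpha>}. VaR M \<beta> X - v)"
    unfolding set_lebesgue_integral_def
  proof (rule Bochner_Integration.integral_cong)
    fix \<beta>
    have "v \<le> VaR M \<beta> X" if "0 < \<beta>" "\<beta> < \<alpha>"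
      unfolding v_def using that \<alpha> by (intro VaR_antimono) auto
    moreover have "VaR M \<beta> X \<le> v" if "\<alpha> \<le> \<beta>" "\<beta> < 1"
      unfolding v_def using that \<alpha> by (intro VaR_antimono) auto
    ultimately show "indicator {0<..<1} \<beta> *\<^sub>R max (VaR M \<beta> X - v) 0
        = indicator {0<..<\<alpha>} \<beta> *\<^sub>R (VaR M \<beta> X - v)"
      using \<alpha> by (auto simp: indicator_def max_def)
  qed simp
  also have "\<dots> = (LBINT \<beta>:{0<..<\<alpha>}. VaR M \<beta> X) - \<alpha> * v"
    using \<alpha> set_integrable_VaR[OF X]
    by (subst set_integral_diff) (auto simp: set_integrable_def set_integral_const_Ioo)
  finally show ?thesis
    using \<alpha> by (simp add: ES_def field_simps)
qed

text \<open>With \<open>Q\<close> and \<open>P\<close> the positive and negative parts of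
  \<open>X + v\<close>, the sum of \<open>ES M \<alpha> X\<close> and the expectation of
  \<open>X\<close> is a combination of their means with nonnegative coefficients.\<close>

lemma
  assumes X: "integrable M X"
  shows ES_ge_expectation: "- expectation X \<le> ES M \<alpha> X"
    and ES_eq_expectation_imp_const: "ES M \<alpha> X = - expectation X \<Longrightarrow> \<exists>c. AE \<omega> in M. X \<omega> = c"
proof -
  define v where "v = VaR M \<alpha> X"
  define P where "P = (\<lambda>\<omega>. max (- X \<omega> - v) 0)"
  define Q where "Q = (\<lambda>\<omega>. max (X \<omega> + v) 0)"
  have int: "integrable M P" "integrable M Q"
    unfolding P_def Q_def using X by auto
  have "X \<omega> = Q \<omega> - P \<omega> - v" for \<omega>
    by (auto simp: P_def Q_def)
  then have "expectation X = expectation (\<lambda>\<omega>. Q \<omega> - P \<omega> - v)"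
    by metis
  also have "\<dots> = expectation Q - expectation P - v"
    using int by (simp add: prob_space)
  finally have E: "expectation X = expectation Q - expectation P - v" .
  have ES: "ES M \<alpha> X = v + 1 / \<alpha> * expectation P"
    unfolding P_def v_def by (rule ES_eq_expectation[OF X])
  have key: "ES M \<alpha> X + expectation X = (1 / \<alpha> - 1) * expectation P + expectation Q"
    unfolding E ES by (simp add: algebra_simps)
  have nonneg: "0 \<le> (1 / \<alpha> - 1) * expectation P" "0 \<le> expectation Q"
    using \<alpha> by (auto simp: P_def Q_def intro!: mult_nonneg_nonneg integral_nonneg)
  with key show "- expectation X \<le> ES M \<alpha> X"
    by linarith
  assume "ES M \<alpha> X = - expectation X"
  with key nonneg have "(1 / \<alpha> - 1) * expectation P = 0" "expectation Q = 0"
    by linarith+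
  \<comment> \<open>Here \<alpha> < 1 enters: the coefficient \<open>1 / \<alpha> - 1\<close> is
    strictly positive.\<close>
  then have "expectation P = 0" "expectation Q = 0"
    using \<alpha> by auto
  then have "AE \<omega> in M. P \<omega> = 0" "AE \<omega> in M. Q \<omega> = 0"
    using int by (auto simp: integral_nonneg_eq_0_iff_AE P_def Q_def)
  then have "AE \<omega> in M. X \<omega> = - v"
    by eventually_elim (auto simp: P_def Q_def)
  then show "\<exists>c. AE \<omega> in M. X \<omega> = c"
    by blast
qed

section \<open>The risk measure based on the asset\<close>

text \<open>A constant payoff acts as cash, so cash additivity turns the acceptable amounts
  \<open>m\<close> into a closed half-line.\<close>

lemma S_ES_risk_free:
  assumes X: "integrable M X" and S: "S1 \<in> borel_measurable M" "AE \<omega> in M. S1 \<omega> = c"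
    and pos: "0 < S0" "0 < c"
  shows "S_ES M (S0, S1) \<alpha> X = S0 / c * ES M \<alpha> X"
proof -
  have [measurable]: "X \<in> borel_measurable M"
    using X by auto
  have "S_ES M (S0, S1) \<alpha> X = S_ES M (S0, \<lambda>_. c) \<alpha> X"
    using S by (intro S_ES_cong_AE) auto
  also have "\<dots> = Inf {S0 / c * ES M \<alpha> X..}"
  proof -
    have "ES M \<alpha> X - m / S0 * c \<le> 0 \<longleftrightarrow> S0 / c * ES M \<alpha> X \<le> m" for m
      using pos by (simp add: field_simps)
    then show ?thesis
      by (simp add: S_ES_def ES_cash_additive[OF X] atLeast_def)
  qed
  finally show ?thesis
    by simp
qed

text \<open>Both signs of \<open>m\<close> matter because the asset may be bought or sold short; a
  negative factor is moved onto \<open>- X\<close>.\<close>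

lemma ES_scale:
  assumes "integrable M X"
  shows "ES M \<alpha> (\<lambda>\<omega>. m * X \<omega>) = (if 0 \<le> m then m * ES M \<alpha> X else - m * ES M \<alpha> (\<lambda>\<omega>. - X \<omega>))"
  using assms ES_pos_homogeneous[of X m] ES_pos_homogeneous[of "\<lambda>\<omega>. - X \<omega>" "- m"] ES_const[of 0]
  by (cases m "0 :: real" rule: linorder_cases) auto

text \<open>On a constant \<open>c\<close>, the Expected Shortfall after investing \<open>m\<close>
  is decreasing and piecewise linear in \<open>m\<close>, with a kink at \<open>0\<close>. The
  infimum is its root, and the sign of \<open>c\<close> decides the branch: a debt is covered by
  buying the asset, a surplus is released by short selling.\<close>

lemma
  assumes S1: "integrable M S1" and \<epsilon>: "0 < \<epsilon>" "AE \<omega> in M. \<epsilon> \<le> S1 \<omega>" and S0: "0 < S0"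
  shows S_ES_minus_one: "S_ES M (S0, S1) \<alpha> (\<lambda>_. - 1) = - S0 / ES M \<alpha> S1"
    and S_ES_zero: "S_ES M (S0, S1) \<alpha> (\<lambda>_. 0) = 0"
    and S_ES_one: "S_ES M (S0, S1) \<alpha> (\<lambda>_. 1) = - S0 / ES M \<alpha> (\<lambda>\<omega>. - S1 \<omega>)"
proof -
  define a where "a = ES M \<alpha> S1"
  define b where "b = ES M \<alpha> (\<lambda>\<omega>. - S1 \<omega>)"
  \<comment> \<open>The lower bound \<epsilon> on the payoff makes both slopes strictly
    negative.\<close>
  have "a \<le> - \<epsilon>"
    unfolding a_def using ES_mono[of "\<lambda>_. \<epsilon>" S1] S1 \<epsilon> by (simp add: ES_const)
  then have a: "a < 0"
    using \<epsilon> by simp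
  have "\<epsilon> \<le> b"
    unfolding b_def using ES_mono[of "\<lambda>\<omega>. - S1 \<omega>" "\<lambda>_. - \<epsilon>"] S1 \<epsilon> by (simp add: ES_const)
  then have b: "0 < b"
    using \<epsilon> by simp
  have *: "ES M \<alpha> (\<lambda>\<omega>. c + m / S0 * S1 \<omega>)
      = (if 0 \<le> m then m / S0 * a else - (m / S0) * b) - c" for c m
    using ES_cash_additive[of "\<lambda>\<omega>. m / S0 * S1 \<omega>" c] ES_scale[OF S1, of "m / S0"] S1 S0
    by (simp add: a_def b_def add.commute zero_le_divide_iff)
  have "{m. ES M \<alpha> (\<lambda>\<omega>. - 1 + m / S0 * S1 \<omega>) \<le> 0} = {- S0 / a..}"
  proof -
    have "(if 0 \<le> m then m / S0 * a else - (m / S0) * b) - (- 1) \<le> 0 \<longleftrightarrow> - S0 / a \<le> m" for m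
    proof (cases "0 \<le> m")
      case True
      then show ?thesis
        using a S0 by (auto simp: field_simps)
    next
      case False
      \<comment> \<open>For negative \<open>m\<close> both sides of the equivalence fail.\<close>
      then have "m / S0 * b < 0" "0 < - S0 / a"
        using a b S0 by (auto simp: mult_neg_pos divide_pos_neg divide_neg_neg divide_neg_pos)
      then show ?thesis
        using False by auto
    qed
    then show ?thesis
      unfolding * by auto
  qed
  then show "S_ES M (S0, S1) \<alpha> (\<lambda>_. - 1) = - S0 / ES M \<alpha> S1"
    by (simp add: S_ES_def a_def)
  have "{m. ES M \<alpha> (\<lambda>\<omega>. 0 + m / S0 * S1 \<omega>) \<le> 0} = {0..}"
    unfolding * using a b S0 by (auto simp: field_simps zero_le_mult_iff mult_le_0_iff)
  then show "S_ES M (S0, S1) \<alpha> (\<lambda>_. 0) = 0"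
    by (simp add: S_ES_def)
  have "{m. ES M \<alpha> (\<lambda>\<omega>. 1 + m / S0 * S1 \<omega>) \<le> 0} = {- S0 / b..}"
  proof -
    have "(if 0 \<le> m then m / S0 * a else - (m / S0) * b) - 1 \<le> 0 \<longleftrightarrow> - S0 / b \<le> m" for m
    proof (cases "0 \<le> m")
      case True
      \<comment> \<open>For nonnegative \<open>m\<close> both sides hold.\<close>
      then have "m / S0 * a \<le> 0" "- S0 / b < 0"
        using a b S0 by (auto simp: mult_nonneg_nonpos divide_nonpos_pos)
      then show ?thesis
        using True by auto
    next
      case False
      then show ?thesis
        using b S0 by (auto simp: field_simps)
    qed
    then show ?thesis
      unfolding * by auto
  qed
  then show "S_ES M (S0, S1) \<alpha> (\<lambda>_. 1) = - S0 / ES M \<alpha> (\<lambda>\<omega>. - S1 \<omega>)"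
    by (simp add: S_ES_def b_def)
qed

end

end

theorem proposition3p7:
  fixes M :: "'a measure" and \<alpha> :: real and S :: "real \<times> ('a \<Rightarrow> real)"
  assumes "prob_space M"
    and "0 < \<alpha>" and "\<alpha> < 1"
    and "eligible_asset M S"
  shows "comonotonic M (S_ES M S \<alpha>) \<longleftrightarrow> risk_free M S"
proof -
  interpret prob_space M by fact
  note \<alpha> = assms(2,3)
  obtain S0 S1 where S: "S = (S0, S1)"
    by (cases S)
  obtain \<epsilon> where S0: "0 < S0" and S1: "S1 \<in> Linf M" and \<epsilon>: "0 < \<epsilon>" "AE \<omega> in M. \<epsilon> \<le> S1 \<omega>"
    using assms(4) by (auto simp: eligible_asset_def Linf_plus_def S)
  have int: "integrable M S1"
    using S1 by (rule Linf_integrable)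
  then have [measurable]: "S1 \<in> borel_measurable M"
    by auto
  show ?thesis
  proof
    assume "risk_free M S"
    then obtain c where c: "AE \<omega> in M. S1 \<omega> = c"
      by (auto simp: risk_free_def S)
    \<comment> \<open>An almost-sure statement free of \<omega> holds outright on a probability
      space, so \<open>c\<close> inherits positivity.\<close>
    with \<epsilon>(2) have "AE \<omega> in M. 0 < c"
      by eventually_elim (use \<epsilon>(1) in simp)
    then have "0 < c"
      by simp
    then have ES: "S_ES M S \<alpha> X = S0 / c * ES M \<alpha> X" if "integrable M X" for X
      unfolding S using \<alpha> that c S0 by (intro S_ES_risk_free) auto
    show "comonotonic M (S_ES M S \<alpha>)"
      unfolding comonotonic_def
    proof (intro ballI impI)
      fix X Y assume XY: "X \<in> Linf M" "Y \<in> Linf M" "comonotone M X Y"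
      then have [simp]: "integrable M X" "integrable M Y"
        by (auto intro: Linf_integrable)
      show "S_ES M S \<alpha> (\<lambda>\<omega>. X \<omega> + Y \<omega>) = S_ES M S \<alpha> X + S_ES M S \<alpha> Y"
        using XY \<alpha> by (simp add: ES ES_comonotone_additive distrib_left)
    qed
  next
    assume "comonotonic M (S_ES M S \<alpha>)"
    \<comment> \<open>The two constants fall on opposite sides of the kink, so additivity links the
      Expected Shortfalls of \<open>S1\<close> and of its negative.\<close>
    then have "S_ES M S \<alpha> (\<lambda>\<omega>. 1 + - 1) = S_ES M S \<alpha> (\<lambda>_. 1) + S_ES M S \<alpha> (\<lambda>_. - 1)"
      unfolding comonotonic_def
      by (elim ballE[where x="\<lambda>_. 1"] ballE[where x="\<lambda>_. - 1"])
         (auto simp: Linf_const comonotone_const)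
    then have "S0 / ES M \<alpha> S1 + S0 / ES M \<alpha> (\<lambda>\<omega>. - S1 \<omega>) = 0"
      using S_ES_one[OF \<alpha> int \<epsilon> S0] S_ES_zero[OF \<alpha> int \<epsilon> S0] S_ES_minus_one[OF \<alpha> int \<epsilon> S0]
      by (simp add: S)
    then have "S0 / ES M \<alpha> S1 = S0 / - ES M \<alpha> (\<lambda>\<omega>. - S1 \<omega>)"
      by simp
    then have "ES M \<alpha> S1 = - ES M \<alpha> (\<lambda>\<omega>. - S1 \<omega>)"
      using S0 unfolding divide_cancel_left by simp
    \<comment> \<open>Applying the lower bound to both \<open>S1\<close> and its negative squeezes
      \<open>ES M \<alpha> S1\<close> into the equality case.\<close>
    moreover have "expectation S1 \<le> ES M \<alpha> (\<lambda>\<omega>. - S1 \<omega>)"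
      using ES_ge_expectation[OF \<alpha>, of "\<lambda>\<omega>. - S1 \<omega>"] int by simp
    moreover have "- expectation S1 \<le> ES M \<alpha> S1"
      using ES_ge_expectation[OF \<alpha> int] .
    ultimately have "ES M \<alpha> S1 = - expectation S1"
      by linarith
    then show "risk_free M S"
      using ES_eq_expectation_imp_const[OF \<alpha> int] by (simp add: risk_free_def S)
  qed
qed

end
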